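(* Let $(X,d_X)$ and $(Y,d_Y)$ be unbounded proper metric spaces. Let $T:\mathcal{SO}(X)\to\mathcal{SO}(Y)$ be a linear lattice isomorphism, and let $\tau:X\to Y$ be the homeomorphism induced by $T$. Then $T=\omega\cdot(\tau^{-1})^{\ast}$ where $\omega=T(1)$; that is, $T(f)(y)=\omega(y)\cdot f(\tau^{-1}(y))$ for all $f\in\mathcal{SO}(X)$ and $y\in Y$. The same representation holds for a linear lattice isomorphism $T:\mathcal{SO}^{\ast}(X)\to\mathcal{SO}^{\ast}(Y)$.
   Context: A metric space is proper if all its closed balls are compact. A continuous $f:X\to\mathbb{R}$ on a proper metric space is slowly oscillating if for every $R>0$ and $\varepsilon>0$ there is a compact $K\subset X$ with $\operatorname{diam} f(B_{d_X}(x,R))<\varepsilon$ for every $x\in X\setminus K$, where $B_{d_X}(x,R)$ is the closed ball. $\mathcal{SO}(X)$ is the vector lattice (pointwise $\wedge=\min$, $\vee=\max$) of all continuous slowly oscillating functions $X\to\mathbb{R}$ and $\mathcal{SO}^{\ast}(X)$ the sublattice of bounded ones. A linear lattice isomorphism is a linear bijection preserving $\vee$ and $\wedge$. For $A(X)$ equal to $\mathcal{SO}(X)$ or $\mathcal{SO}^{\ast}(X)$, a homeomorphism $\tau:X\to Y$ is induced by a lattice isomorphism $T:A(X)\to A(Y)$ if for all $f,g\in A(X)$ and every open $U\subset X$: $f\ge g$ on $U$ iff $T(f)\ge T(g)$ on $\tau(U)$; such a $\tau$ exists and is unique, and it satisfies: $T(f)(y)=T(g)(y)$ iff $f(\tau^{-1}(y))=g(\tau^{-1}(y))$,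 for all $f,g\in A(X)$, $y\in Y$. For a continuous map $h$, $h^{\ast}(f)=f\circ h$. *)

theory Defs
  imports "HOL-Analysis.Analysis"
begin

definition proper_space :: "'a::metric_space itself \<Rightarrow> bool" where
  "proper_space _ \<longleftrightarrow> (\<forall>(x::'a) r. compact (cball x r))"

(* In a proper space the sets f ` cball x R are bounded for continuous f, so the
   library's diameter is the true supremum of distances wherever it is used below. *)
definition slowly_oscillating :: "('a::metric_space \<Rightarrow> real) \<Rightarrow> bool" where
  "slowly_oscillating f \<longleftrightarrow>
     (\<forall>R>0. \<forall>\<epsilon>>0. \<exists>K. compact K \<and> (\<forall>x\<in>UNIV - K. diameter (f ` cball x R) < \<epsilon>))"

definition SO :: "('a::metric_space \<Rightarrow> real) set" where
  "SO = {f. continuous_on UNIV f \<and> slowly_oscillating f}"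

definition SO_bdd :: "('a::metric_space \<Rightarrow> real) set" where
  "SO_bdd = {f \<in> SO. bounded (range f)}"

(* T is a total function on all of 'a => real; only its values on A matter. *)
definition linear_lattice_iso ::
  "('a \<Rightarrow> real) set \<Rightarrow> ('b \<Rightarrow> real) set \<Rightarrow> (('a \<Rightarrow> real) \<Rightarrow> ('b \<Rightarrow> real)) \<Rightarrow> bool" where
  "linear_lattice_iso A B T \<longleftrightarrow>
     bij_betw T A B \<and>
     (\<forall>f\<in>A. \<forall>g\<in>A. T (\<lambda>x. f x + g x) = (\<lambda>y. T f y + T g y)) \<and>
     (\<forall>c. \<forall>f\<in>A. T (\<lambda>x. c * f x) = (\<lambda>y. c * T f y)) \<and>
     (\<forall>f\<in>A. \<forall>g\<in>A. T (\<lambda>x. max (f x) (g x)) = (\<lambda>y. max (T f y) (T g y))) \<and>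
     (\<forall>f\<in>A. \<forall>g\<in>A. T (\<lambda>x. min (f x) (g x)) = (\<lambda>y. min (T f y) (T g y)))"

definition induced_homeomorphism ::
  "('a::metric_space \<Rightarrow> real) set \<Rightarrow> (('a \<Rightarrow> real) \<Rightarrow> ('b::metric_space \<Rightarrow> real)) \<Rightarrow> ('a \<Rightarrow> 'b) \<Rightarrow> bool" where
  "induced_homeomorphism A T \<tau> \<longleftrightarrow>
     homeomorphism UNIV UNIV \<tau> (inv \<tau>) \<and>
     (\<forall>f\<in>A. \<forall>g\<in>A. \<forall>U. open U \<longrightarrow>
        ((\<forall>x\<in>U. f x \<ge> g x) \<longleftrightarrow> (\<forall>y\<in>\<tau> ` U. T f y \<ge> T g y)))"

end

theory Submission imports Defs
begin

text \<open>
  Near a point \<open>x = inv \<tau> y\<close>, a continuous \<open>f\<close> is squeezed between the constants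
  \<open>f x - \<epsilon>\<close> and \<open>f x + \<epsilon>\<close>. The homeomorphism induced by \<open>T\<close> carries inequalities that hold on
  a neighbourhood of \<open>x\<close> to inequalities between the images under \<open>T\<close> on a neighbourhood
  of \<open>y\<close>, and by homogeneity the image of a constant \<open>c\<close> is \<open>c * T 1\<close>. Hence \<open>T f y\<close> lies between
  \<open>(f x - \<epsilon>) * T 1 y\<close> and \<open>(f x + \<epsilon>) * T 1 y\<close>, and letting \<open>\<epsilon>\<close> tend to \<open>0\<close> gives the formula.
  Constants are slowly oscillating and bounded, so the same argument covers both function spaces.
\<close>

lemma const_in_SO: "(\<lambda>_::'a::metric_space. c) \<in> SO"
proof -
  have "diameter ((\<lambda>_. c) ` cball x R) < e" if "e > 0" for x :: 'a and R e :: real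
    using that by (cases "cball x R = {}") (auto simp: image_constant_conv)
  then show ?thesis
    unfolding SO_def slowly_oscillating_def by (auto intro!: exI[of _ "{}"])
qed

lemma const_in_SO_bdd: "(\<lambda>_::'a::metric_space. c) \<in> SO_bdd"
  by (simp add: SO_bdd_def const_in_SO)

text \<open>
  Since the comparison of images is tested on arbitrarily small open sets, \<open>T f y\<close> depends
  monotonically on the germ of \<open>f\<close> at \<open>inv \<tau> y\<close>; this is how locality of \<open>T\<close> enters.
\<close>

lemma induced_homeomorphism_local_mono:
  assumes ind: "induced_homeomorphism A T \<tau>" and "f \<in> A" "g \<in> A"
    and ge: "\<forall>\<^sub>F x in nhds (inv \<tau> y). f x \<ge> g x"
  shows "T f y \<ge> T g y"
proof -
  obtain U where U: "open U" "inv \<tau> y \<in> U" "\<forall>x\<in>U. f x \<ge> g x"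
    using ge unfolding eventually_nhds by blast
  have "\<forall>z\<in>\<tau> ` U. T f z \<ge> T g z"
    using ind U \<open>f \<in> A\<close> \<open>g \<in> A\<close> unfolding induced_homeomorphism_def by blast
  moreover have "\<tau> (inv \<tau> y) = y"
    using ind unfolding induced_homeomorphism_def homeomorphism_def by blast
  ultimately show ?thesis
    using U(2) by force
qed

lemma induced_homeomorphism_weighted_composition:
  fixes T :: "('a::metric_space \<Rightarrow> real) \<Rightarrow> ('b::metric_space \<Rightarrow> real)"
  assumes ind: "induced_homeomorphism A T \<tau>"
    and hom: "\<And>c f. f \<in> A \<Longrightarrow> T (\<lambda>x. c * f x) = (\<lambda>y. c * T f y)"
    and const: "\<And>c. (\<lambda>_. c) \<in> A"
    and "f \<in> A" and cont: "continuous_on UNIV f"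
  shows "T f y = T (\<lambda>_. 1) y * f (inv \<tau> y)"
proof -
  let ?x = "inv \<tau> y" and ?w = "T (\<lambda>_. 1) y"
  have T_const: "T (\<lambda>_. c) y = c * ?w" for c
    using hom[OF const[of 1], of c] by simp
  have lim: "(f \<longlongrightarrow> f ?x) (nhds ?x)"
    using cont by (simp add: continuous_on_eq_continuous_at tendsto_at_iff_tendsto_nhds[symmetric]
        isCont_def)
  have upper: "T f y \<le> (f ?x + e) * ?w" and lower: "(f ?x - e) * ?w \<le> T f y" if "e > 0" for e
  proof -
    have "\<forall>\<^sub>F x in nhds ?x. f x < f ?x + e" "\<forall>\<^sub>F x in nhds ?x. f ?x - e < f x"
      using that by (auto intro: order_tendstoD[OF lim])
    then have "\<forall>\<^sub>F x in nhds ?x. f x \<le> f ?x + e" "\<forall>\<^sub>F x in nhds ?x. f ?x - e \<le> f x"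
      by (auto elim: eventually_mono)
    then show "T f y \<le> (f ?x + e) * ?w" "(f ?x - e) * ?w \<le> T f y"
      using induced_homeomorphism_local_mono[OF ind const \<open>f \<in> A\<close>]
        induced_homeomorphism_local_mono[OF ind \<open>f \<in> A\<close> const]
      by (simp_all flip: T_const)
  qed
  have "((\<lambda>e. (f ?x + e) * ?w) \<longlongrightarrow> (f ?x + 0) * ?w) (at_right 0)"
    by (intro tendsto_intros)
  then have "T f y \<le> (f ?x + 0) * ?w"
    by (rule tendsto_lowerbound) (auto simp: eventually_at_filter upper)
  moreover have "((\<lambda>e. (f ?x - e) * ?w) \<longlongrightarrow> (f ?x - 0) * ?w) (at_right 0)"
    by (intro tendsto_intros)
  then have "(f ?x - 0) * ?w \<le> T f y"
    by (rule tendsto_upperbound) (auto simp: eventually_at_filter lower)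
  ultimately show ?thesis
    by (simp add: mult.commute)
qed

theorem theorem3p8:
  assumes "proper_space TYPE('a::metric_space)" and "\<not> bounded (UNIV :: 'a set)"
    and "proper_space TYPE('b::metric_space)" and "\<not> bounded (UNIV :: 'b set)"
  shows "(\<forall>(T :: ('a \<Rightarrow> real) \<Rightarrow> ('b \<Rightarrow> real)) \<tau>.
            linear_lattice_iso SO SO T \<and> induced_homeomorphism SO T \<tau> \<longrightarrow>
            (\<forall>f\<in>SO. \<forall>y. T f y = T (\<lambda>_. 1) y * f (inv \<tau> y))) \<and>
         (\<forall>(T :: ('a \<Rightarrow> real) \<Rightarrow> ('b \<Rightarrow> real)) \<tau>.
            linear_lattice_iso SO_bdd SO_bdd T \<and> induced_homeomorphism SO_bdd T \<tau> \<longrightarrow>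
            (\<forall>f\<in>SO_bdd. \<forall>y. T f y = T (\<lambda>_. 1) y * f (inv \<tau> y)))"
  by (intro conjI allI impI ballI;
      rule induced_homeomorphism_weighted_composition;
      auto simp: linear_lattice_iso_def const_in_SO const_in_SO_bdd; simp add: SO_bdd_def SO_def)

end
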